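(* Let $[a,b]\subset\mathbb R$, let $X=C([a,b])$ be the space of real continuous functions on $[a,b]$ with the norm $\|x\|_\infty=\sup_{t\in[a,b]}|x(t)|$, and let $g\in X$. Let $K\colon[a,b]\times[a,b]\to\mathbb R$ be measurable with $$M:=\sup_{t\in[a,b]}\int_a^b|K(t,s)|\,ds<\infty .$$ Let $f\colon[a,b]\times\mathbb R\to\mathbb R$ be continuous in the second variable, satisfy $|f(s,u)-f(s,v)|\le L_f|u-v|$ for all $s\in[a,b]$, $u,v\in\mathbb R$, with an explicit constant $L_f\ge0$, and satisfy $M_{f_0}:=\sup_{s\in[a,b]}|f(s,0)|<\infty$. Define $T\colon X\to X$ by $$(Tx)(t):=g(t)+\int_a^bK(t,s)\,f(s,x(s))\,ds ,\qquad t\in[a,b].$$ Assume $L:=L_fM<1$ and put $$R:=\frac{\|g\|_\infty+M\,M_{f_0}}{1-L},\qquad C:=\{x\in X:\|x\|_\infty\le R\}.$$ Then the Hammerstein equation $$x(t)=g(t)+\int_a^bK(t,s)\,f(s,x(s))\,ds,\qquad t\in[a,b],$$ has a unique solution $x^\ast\in C$. For any $x_0\in C$, the Picard iterates $x_{n+1}:=Tx_n$ satisfy $$\|x_n-x^\ast\|_\infty\le\frac{L^{n}}{1-L}\,\delta_0,\qquad \delta_0:=\|Tx_0-x_0\|_\infty ,$$ for all $n\in\mathbb N$.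
   Context: $\mathbb N=\{0,1,2,\dots\}$.
   Formalization: That T maps X into X, with s ↦ K(t,s)f(s,x(s)) integrable for all x in X and t in [a,b], is taken as a hypothesis; the conditions on K and f do not imply it (K(t,s)=1 for t>c, else 0, with f=1, g=0 gives a discontinuous Tx). *)

theory Defs
  imports "HOL-Analysis.Analysis"
begin

text \<open>
  Elements of \<open>C([a,b])\<close> are extensional on \<open>{a..b}\<close> (undefined outside the interval), so that
  HOL equality of two elements is equality as functions on the interval.
\<close>
definition cont_space :: "real \<Rightarrow> real \<Rightarrow> (real \<Rightarrow> real) set" where
  "cont_space a b = {x \<in> extensional {a..b}. continuous_on {a..b} x}"

definition sup_norm :: "real \<Rightarrow> real \<Rightarrow> (real \<Rightarrow> real) \<Rightarrow> real" where
  "sup_norm a b x = (SUP t\<in>{a..b}. \<bar>x t\<bar>)"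

text \<open>
  The bound is taken in the extended nonnegative reals, so that its finiteness is a genuine
  condition.  Should a section \<open>K t\<close> fail to be Lebesgue measurable (joint Lebesgue measurability
  gives this only for almost every \<open>t\<close>), the nonnegative integral is the lower integral.
\<close>
definition kernel_bound :: "real \<Rightarrow> real \<Rightarrow> (real \<Rightarrow> real \<Rightarrow> real) \<Rightarrow> ennreal" where
  "kernel_bound a b K = (SUP t\<in>{a..b}. \<integral>\<^sup>+ s. ennreal \<bar>K t s\<bar> \<partial>lebesgue_on {a..b})"

definition hammerstein_op ::
  "real \<Rightarrow> real \<Rightarrow> (real \<Rightarrow> real) \<Rightarrow> (real \<Rightarrow> real \<Rightarrow> real) \<Rightarrow> (real \<Rightarrow> real \<Rightarrow> real)
    \<Rightarrow> (real \<Rightarrow> real) \<Rightarrow> real \<Rightarrow> real" where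
  "hammerstein_op a b g K f x =
     (\<lambda>t\<in>{a..b}. g t + (\<integral>s. K t s * f s (x s) \<partial>lebesgue_on {a..b}))"

text \<open>
  The operator is well defined as a self-map of \<open>C([a,b])\<close>.  Integrability is stated explicitly
  because the Bochner integral of a non-integrable function is \<open>0\<close> by convention.  Neither part
  follows from the other hypotheses on \<open>K\<close> and \<open>f\<close>: measurability of \<open>f\<close> in its first variable
  is not assumed, and \<open>K t s = (if t > c then 1 else 0)\<close> with \<open>a < c < b\<close> and \<open>f = 1\<close> gives a
  discontinuous image.
\<close>
definition hammerstein_well_defined ::
  "real \<Rightarrow> real \<Rightarrow> (real \<Rightarrow> real) \<Rightarrow> (real \<Rightarrow> real \<Rightarrow> real) \<Rightarrow> (real \<Rightarrow> real \<Rightarrow> real) \<Rightarrow> bool" where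
  "hammerstein_well_defined a b g K f \<longleftrightarrow>
     (\<forall>x\<in>cont_space a b. \<forall>t\<in>{a..b}. integrable (lebesgue_on {a..b}) (\<lambda>s. K t s * f s (x s))) \<and>
     hammerstein_op a b g K f \<in> cont_space a b \<rightarrow> cont_space a b"

definition hammerstein_solution ::
  "real \<Rightarrow> real \<Rightarrow> (real \<Rightarrow> real) \<Rightarrow> (real \<Rightarrow> real \<Rightarrow> real) \<Rightarrow> (real \<Rightarrow> real \<Rightarrow> real)
    \<Rightarrow> (real \<Rightarrow> real) \<Rightarrow> bool" where
  "hammerstein_solution a b g K f x \<longleftrightarrow>
     (\<forall>t\<in>{a..b}. x t = g t + (\<integral>s. K t s * f s (x s) \<partial>lebesgue_on {a..b}))"

end

theory Submission
  imports Defs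
begin

text \<open>
  By the Lipschitz condition, \<open>T\<close> is an \<open>L\<close>-contraction of the complete space \<open>C([a,b])\<close>, so it has
  exactly one fixed point in the whole space.  The fixed point equation itself gives
  \<open>\<parallel>z\<parallel> \<le> \<parallel>g\<parallel> + M (M\<^sub>f\<^sub>0 + L\<^sub>f \<parallel>z\<parallel>)\<close>, that is \<open>\<parallel>z\<parallel> \<le> R\<close>, so this fixed point lies in \<open>C\<close> and the
  invariance of \<open>C\<close> under \<open>T\<close> is never needed.
\<close>

text \<open>Iterating the contraction bounds \<open>d (x n) z\<close> by
  \<open>k ^ n * d (x 0) z\<close>. The unknown factor \<open>d (x 0) z\<close> is removed by the
  triangle inequality through \<open>f (x 0)\<close>: it is at most
  \<open>d (f (x 0)) (x 0) + k * d (x 0) z\<close>, and the last term is absorbed on the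
  left.\<close>

lemma (in Metric_space) Picard_iterates_bound:
  assumes fim: "f \<in> M \<rightarrow> M" and k: "0 \<le> k" "k < 1"
    and con: "\<And>x y. \<lbrakk>x \<in> M; y \<in> M\<rbrakk> \<Longrightarrow> d (f x) (f y) \<le> k * d x y"
    and z: "z \<in> M" "f z = z"
    and x: "x 0 \<in> M" "\<And>n. x (Suc n) = f (x n)"
  shows "d (x n) z \<le> k ^ n / (1 - k) * d (f (x 0)) (x 0)"
proof -
  have xM: "x n \<in> M" for n
    by (induction n) (use fim x in auto)
  have 1: "d (x n) z \<le> k ^ n * d (x 0) z" for n
  proof (induction n)
    case (Suc n)
    have "d (x (Suc n)) z \<le> k * d (x n) z"
      using con[OF xM z(1)] x(2) z(2) by metis
    also have "\<dots> \<le> k * (k ^ n * d (x 0) z)"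
      using Suc k(1) by (rule mult_left_mono)
    finally show ?case by (simp add: mult.assoc)
  qed simp
  have "d (x 0) z \<le> d (f (x 0)) (x 0) + d (f (x 0)) z"
    using triangle'[of "x 0" "f (x 0)" z] fim x(1) z(1) commute by auto
  also have "\<dots> \<le> d (f (x 0)) (x 0) + k * d (x 0) z"
    using con[OF x(1) z(1)] z(2) by simp
  finally have "d (x 0) z \<le> d (f (x 0)) (x 0) / (1 - k)"
    using k(2) by (simp add: pos_le_divide_eq algebra_simps)
  then have "k ^ n * d (x 0) z \<le> k ^ n * (d (f (x 0)) (x 0) / (1 - k))"
    using k(1) by (intro mult_left_mono) auto
  with 1[of n] show ?thesis by simp
qed

text \<open>In the application \<open>k\<close> is a section \<open>K t\<close>, which may fail to
  be measurable, so the integral on the right may be only a lower integral.\<close>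

lemma norm_integral_mult_le_nn_integral:
  fixes k \<phi> :: "'a \<Rightarrow> real"
  assumes int: "integrable M (\<lambda>s. k s * \<phi> s)"
    and bound: "\<And>s. s \<in> space M \<Longrightarrow> \<bar>\<phi> s\<bar> \<le> c" and "0 \<le> c"
  shows "ennreal \<bar>\<integral>s. k s * \<phi> s \<partial>M\<bar> \<le> ennreal c * (\<integral>\<^sup>+ s. ennreal \<bar>k s\<bar> \<partial>M)"
\<comment> \<open>The other case divides by \<open>c\<close>; here the bound makes
  \<open>\<phi>\<close> vanish on the whole space, so both sides are zero.\<close>
proof (cases "c = 0")
  case True
  then have "(\<integral>s. k s * \<phi> s \<partial>M) = (\<integral>s. 0 \<partial>M)"
    by (intro Bochner_Integration.integral_cong) (use bound in force)+
  then show ?thesis by simp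
next
  case False
  with \<open>0 \<le> c\<close> have c: "0 < c" by simp
  \<comment> \<open>Only the product is known to be measurable, so \<open>c\<close> is pulled out of the integral before the
    integrand is compared with \<open>k\<close>.\<close>
  have [measurable]: "(\<lambda>s. k s * \<phi> s) \<in> borel_measurable M"
    using int by auto
  have "ennreal \<bar>\<integral>s. k s * \<phi> s \<partial>M\<bar> \<le> (\<integral>\<^sup>+ s. ennreal \<bar>k s * \<phi> s\<bar> \<partial>M)"
    using integral_norm_bound_ennreal[OF int] by simp
  also have "\<dots> = (\<integral>\<^sup>+ s. ennreal c * ennreal (\<bar>k s * \<phi> s\<bar> / c) \<partial>M)"
    using c by (simp flip: ennreal_mult)
  also have "\<dots> = ennreal c * (\<integral>\<^sup>+ s. ennreal (\<bar>k s * \<phi> s\<bar> / c) \<partial>M)"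
    by (rule nn_integral_cmult) measurable
  also have "\<dots> \<le> ennreal c * (\<integral>\<^sup>+ s. ennreal \<bar>k s\<bar> \<partial>M)"
  proof (intro mult_left_mono nn_integral_mono ennreal_leI)
    fix s assume "s \<in> space M"
    from mult_left_mono[OF bound[OF this], of "\<bar>k s\<bar>"]
    show "\<bar>k s * \<phi> s\<bar> / c \<le> \<bar>k s\<bar>"
      using c by (simp add: pos_divide_le_eq abs_mult)
  qed simp
  finally show ?thesis .
qed

text \<open>One estimate serves twice: with \<open>f s (x s) - f s (y s)\<close> as
  \<open>\<phi>\<close> it yields the contraction, with \<open>f s (z s)\<close> the bound on the
  norm of a solution.\<close>

lemma abs_kernel_integral_le:
  assumes fin: "kernel_bound a b K < \<infinity>" and t: "t \<in> {a..b}"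
    and int: "integrable (lebesgue_on {a..b}) (\<lambda>s. K t s * \<phi> s)"
    and bound: "\<And>s. s \<in> {a..b} \<Longrightarrow> \<bar>\<phi> s\<bar> \<le> c" and "0 \<le> c"
  shows "\<bar>\<integral>s. K t s * \<phi> s \<partial>lebesgue_on {a..b}\<bar> \<le> enn2real (kernel_bound a b K) * c"
proof -
  have "ennreal \<bar>\<integral>s. K t s * \<phi> s \<partial>lebesgue_on {a..b}\<bar>
      \<le> ennreal c * (\<integral>\<^sup>+ s. ennreal \<bar>K t s\<bar> \<partial>lebesgue_on {a..b})"
    using int bound \<open>0 \<le> c\<close> by (intro norm_integral_mult_le_nn_integral) auto
  also have "\<dots> \<le> ennreal c * kernel_bound a b K"
    unfolding kernel_bound_def using t by (intro mult_left_mono SUP_upper) auto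
  \<comment> \<open>Finiteness enters here: \<open>enn2real\<close> sends infinity to 0, so the
    equality could fail for an infinite bound.\<close>
  also have "\<dots> = ennreal (enn2real (kernel_bound a b K) * c)"
    using fin \<open>0 \<le> c\<close> by (simp add: ennreal_mult mult.commute)
  finally show ?thesis
    using \<open>0 \<le> c\<close> by (simp add: ennreal_le_iff)
qed

text \<open>\<open>cfunspace\<close> consists of the bounded continuous functions, extensional on
  the domain, with the uniform metric. Boundedness is automatic on a compact interval, so this
  presents \<open>cont_space\<close> as a metric space to which Banach's fixed point theorem
  applies.\<close>

definition cont_metric :: "real \<Rightarrow> real \<Rightarrow> (real \<Rightarrow> real) metric" where
  "cont_metric a b = cfunspace (top_of_set {a..b}) euclidean_metric"

lemma mspace_cont_metric: "mspace (cont_metric a b) = cont_space a b"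
proof -
  have "bounded (x ` {a..b})" if "continuous_on {a..b} x" for x :: "real \<Rightarrow> real"
    using that by (intro compact_imp_bounded compact_continuous_image) auto
  then show ?thesis
    by (auto simp: cont_metric_def cont_space_def)
qed

lemma mcomplete_cont_metric:
  "Metric_space.mcomplete (cont_space a b) (mdist (cont_metric a b))"
proof -
  have "Met_TC.mcomplete TYPE(real)"
    by (simp add: complete_UNIV)
  from Met_TC.mcomplete_cfunspace[OF this, of "top_of_set {a..b}"]
  \<comment> \<open>\<open>euclidean_metric\<close> and \<open>Met_TC.Self\<close> both unfold to
    the type-class metric on the reals.\<close>
  have "mcomplete_of (cont_metric a b)"
    by (simp add: cont_metric_def euclidean_metric_def Met_TC.Self_def)
  then show ?thesis
    by (simp add: mcomplete_of_def mspace_cont_metric)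
qed

text \<open>A real \<open>SUP\<close> is meaningful only over a nonempty set that is bounded above:
  \<open>a \<le> b\<close> gives the former, compactness the latter. Taking the norm itself for
  \<open>c\<close> yields the pointwise bound on \<open>x\<close>.\<close>

lemma sup_norm_le_iff:
  assumes "a \<le> b" "continuous_on {a..b} x"
  shows "sup_norm a b x \<le> c \<longleftrightarrow> (\<forall>t\<in>{a..b}. \<bar>x t\<bar> \<le> c)"
proof -
  have "bdd_above ((\<lambda>t. \<bar>x t\<bar>) ` {a..b})"
    using assms(2) by (intro bounded_imp_bdd_above compact_imp_bounded compact_continuous_image
        continuous_on_rabs) auto
  with \<open>a \<le> b\<close> show ?thesis
    unfolding sup_norm_def by (subst cSUP_le_iff) auto
qed

lemma mdist_cont_metric:
  assumes "a \<le> b" "x \<in> cont_space a b" "y \<in> cont_space a b"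
  shows "mdist (cont_metric a b) x y = sup_norm a b (\<lambda>t. x t - y t)"
proof -
  \<comment> \<open>Two reals with the same upper bounds are equal, and for both distances an upper
    bound is a pointwise bound on the difference.\<close>
  have "mdist (cont_metric a b) x y \<le> c \<longleftrightarrow> sup_norm a b (\<lambda>t. x t - y t) \<le> c" for c
  proof -
    have "mdist (cont_metric a b) x y \<le> c \<longleftrightarrow> (\<forall>t\<in>{a..b}. \<bar>x t - y t\<bar> \<le> c)"
      using assms cfunspace_mdist_le[of x "top_of_set {a..b}" euclidean_metric y c]
      by (simp add: mspace_cont_metric flip: cont_metric_def dist_real_def)
    moreover have "continuous_on {a..b} (\<lambda>t. x t - y t)"
      using assms by (auto simp: cont_space_def intro!: continuous_intros)
    ultimately show ?thesis
      using sup_norm_le_iff[OF \<open>a \<le> b\<close>] by simp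
  qed
  from this[of "mdist (cont_metric a b) x y"] this[of "sup_norm a b (\<lambda>t. x t - y t)"]
  show ?thesis by simp
qed

text \<open>In the difference of the two images \<open>g\<close> cancels. The integrals combine into
  one because well-definedness makes both integrands integrable; the Lipschitz condition then bounds
  the factor beside \<open>K t s\<close> uniformly in \<open>s\<close>.\<close>

lemma hammerstein_op_contraction:
  assumes "a \<le> b" and fin: "kernel_bound a b K < \<infinity>" and "0 \<le> l"
    and lip: "\<And>s u v. s \<in> {a..b} \<Longrightarrow> \<bar>f s u - f s v\<bar> \<le> l * \<bar>u - v\<bar>"
    and wd: "hammerstein_well_defined a b g K f"
    and x: "x \<in> cont_space a b" and y: "y \<in> cont_space a b"
  shows "mdist (cont_metric a b) (hammerstein_op a b g K f x) (hammerstein_op a b g K f y)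
    \<le> l * enn2real (kernel_bound a b K) * mdist (cont_metric a b) x y"
proof -
  let ?T = "hammerstein_op a b g K f" and ?D = "sup_norm a b (\<lambda>t. x t - y t)"
  have cont: "continuous_on {a..b} (\<lambda>t. u t - v t)"
    if "u \<in> cont_space a b" "v \<in> cont_space a b" for u v
    using that by (auto simp: cont_space_def intro!: continuous_intros)
  have D: "\<bar>x s - y s\<bar> \<le> ?D" if "s \<in> {a..b}" for s
    using sup_norm_le_iff[OF \<open>a \<le> b\<close> cont[OF x y], of ?D] that by simp
  have D0: "0 \<le> ?D"
    using D[of a] \<open>a \<le> b\<close> by simp
  have T: "?T x \<in> cont_space a b" "?T y \<in> cont_space a b"
    using wd x y by (auto simp: hammerstein_well_defined_def)
  have "\<bar>?T x t - ?T y t\<bar> \<le> l * enn2real (kernel_bound a b K) * ?D" if t: "t \<in> {a..b}" for t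
  proof -
    have int: "integrable (lebesgue_on {a..b}) (\<lambda>s. K t s * f s (u s))"
      if "u \<in> cont_space a b" for u
      using wd that t by (auto simp: hammerstein_well_defined_def)
    have "?T x t - ?T y t = (\<integral>s. K t s * (f s (x s) - f s (y s)) \<partial>lebesgue_on {a..b})"
      using t int[OF x] int[OF y] by (simp add: hammerstein_op_def right_diff_distrib)
    moreover have "\<bar>\<integral>s. K t s * (f s (x s) - f s (y s)) \<partial>lebesgue_on {a..b}\<bar>
        \<le> enn2real (kernel_bound a b K) * (l * ?D)"
    proof (rule abs_kernel_integral_le[OF fin t])
      show "integrable (lebesgue_on {a..b}) (\<lambda>s. K t s * (f s (x s) - f s (y s)))"
        using int[OF x] int[OF y] by (simp add: right_diff_distrib)
      show "\<bar>f s (x s) - f s (y s)\<bar> \<le> l * ?D" if "s \<in> {a..b}" for s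
        using lip[OF that, of "x s" "y s"] mult_left_mono[OF D[OF that] \<open>0 \<le> l\<close>] by linarith
    qed (use \<open>0 \<le> l\<close> D0 in simp)
    ultimately show ?thesis by (simp add: ac_simps)
  qed
  then show ?thesis
    using \<open>a \<le> b\<close> x y T cont[OF T] by (simp add: mdist_cont_metric sup_norm_le_iff)
qed

text \<open>The equation speaks only of points of the interval, the fixed point property of whole
  functions. They agree because \<open>z\<close> and its image are both extensional on
  \<open>{a..b}\<close>.\<close>

lemma hammerstein_solution_iff_fixed_point:
  assumes "z \<in> cont_space a b"
  shows "hammerstein_solution a b g K f z \<longleftrightarrow> hammerstein_op a b g K f z = z"
proof
  assume "hammerstein_solution a b g K f z"
  with assms show "hammerstein_op a b g K f z = z"
    by (intro extensionalityI[of _ "{a..b}"])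
      (auto simp: hammerstein_op_def hammerstein_solution_def cont_space_def)
next
  assume fixed: "hammerstein_op a b g K f z = z"
  show "hammerstein_solution a b g K f z"
    unfolding hammerstein_solution_def
  proof
    fix t assume "t \<in> {a..b}"
    then show "z t = g t + (\<integral>s. K t s * f s (z s) \<partial>lebesgue_on {a..b})"
      using fun_cong[OF fixed, of t] by (simp add: hammerstein_op_def)
  qed
qed

lemma sup_norm_hammerstein_solution_le:
  assumes "a \<le> b" and g: "g \<in> cont_space a b" and fin: "kernel_bound a b K < \<infinity>"
    and M: "M = enn2real (kernel_bound a b K)" and "0 \<le> l"
    and lip: "\<And>s u v. s \<in> {a..b} \<Longrightarrow> \<bar>f s u - f s v\<bar> \<le> l * \<bar>u - v\<bar>"
    and f0: "\<And>s. s \<in> {a..b} \<Longrightarrow> \<bar>f s 0\<bar> \<le> c"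
    and wd: "hammerstein_well_defined a b g K f" and "l * M < 1"
    and z: "z \<in> cont_space a b" and sol: "hammerstein_solution a b g K f z"
  shows "sup_norm a b z \<le> (sup_norm a b g + M * c) / (1 - l * M)"
proof -
  have bound: "\<bar>x s\<bar> \<le> sup_norm a b x" if "x \<in> cont_space a b" "s \<in> {a..b}" for x s
    using sup_norm_le_iff[OF \<open>a \<le> b\<close>, of x "sup_norm a b x"] that by (auto simp: cont_space_def)
  \<comment> \<open>Evaluation at the point \<open>a\<close> gives both signs, which make
    \<open>c + l * sup_norm a b z\<close> an admissible nonnegative bound for the integral
    estimate.\<close>
  have "0 \<le> sup_norm a b z" "0 \<le> c"
    using bound[OF z, of a] f0[of a] \<open>a \<le> b\<close> by auto
  have "\<bar>z t\<bar> \<le> sup_norm a b g + M * (c + l * sup_norm a b z)" if t: "t \<in> {a..b}" for t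
  proof -
    have "\<bar>\<integral>s. K t s * f s (z s) \<partial>lebesgue_on {a..b}\<bar> \<le> M * (c + l * sup_norm a b z)"
      unfolding M
    proof (rule abs_kernel_integral_le[OF fin t])
      show "integrable (lebesgue_on {a..b}) (\<lambda>s. K t s * f s (z s))"
        using wd z t by (auto simp: hammerstein_well_defined_def)
      show "\<bar>f s (z s)\<bar> \<le> c + l * sup_norm a b z" if "s \<in> {a..b}" for s
        using lip[OF that, of "z s" 0] mult_left_mono[OF bound[OF z that] \<open>0 \<le> l\<close>] f0[OF that]
        by simp
    qed (use \<open>0 \<le> l\<close> \<open>0 \<le> c\<close> \<open>0 \<le> sup_norm a b z\<close> in simp)
    moreover have "z t = g t + (\<integral>s. K t s * f s (z s) \<partial>lebesgue_on {a..b})"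
      using sol t by (simp add: hammerstein_solution_def)
    ultimately show ?thesis
      using bound[OF g t] by linarith
  qed
  then have "sup_norm a b z \<le> sup_norm a b g + M * (c + l * sup_norm a b z)"
    using z \<open>a \<le> b\<close> by (subst sup_norm_le_iff) (auto simp: cont_space_def)
  with \<open>l * M < 1\<close> show ?thesis
    by (simp add: pos_le_divide_eq algebra_simps)
qed

theorem theorem8p3:
  fixes a b :: real
    and g :: "real \<Rightarrow> real"
    and K f :: "real \<Rightarrow> real \<Rightarrow> real"
    and L\<^sub>f M M\<^sub>f\<^sub>0 L R :: real
    and T :: "(real \<Rightarrow> real) \<Rightarrow> (real \<Rightarrow> real)"
    and C :: "(real \<Rightarrow> real) set"
  assumes "a \<le> b"
    and "g \<in> cont_space a b"
    and "case_prod K \<in> borel_measurable (lebesgue_on ({a..b} \<times> {a..b}))"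
    and "kernel_bound a b K < \<infinity>"
    and "M = enn2real (kernel_bound a b K)"
    and "\<forall>s\<in>{a..b}. continuous_on UNIV (f s)"
    and "L\<^sub>f \<ge> 0"
    and "\<forall>s\<in>{a..b}. \<forall>u v. \<bar>f s u - f s v\<bar> \<le> L\<^sub>f * \<bar>u - v\<bar>"
    and "bdd_above ((\<lambda>s. \<bar>f s 0\<bar>) ` {a..b})"
    and "M\<^sub>f\<^sub>0 = (SUP s\<in>{a..b}. \<bar>f s 0\<bar>)"
    and "hammerstein_well_defined a b g K f"
    and "T = hammerstein_op a b g K f"
    and "L = L\<^sub>f * M"
    and "L < 1"
    and "R = (sup_norm a b g + M * M\<^sub>f\<^sub>0) / (1 - L)"
    and "C = {x \<in> cont_space a b. sup_norm a b x \<le> R}"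
  shows "(\<exists>!z. z \<in> C \<and> hammerstein_solution a b g K f z) \<and>
    (\<forall>z\<in>C. hammerstein_solution a b g K f z \<longrightarrow>
      (\<forall>x :: nat \<Rightarrow> real \<Rightarrow> real. x 0 \<in> C \<longrightarrow> (\<forall>n. x (Suc n) = T (x n)) \<longrightarrow>
        (\<forall>n. sup_norm a b (\<lambda>t. x n t - z t)
              \<le> L ^ n / (1 - L) * sup_norm a b (\<lambda>t. T (x 0) t - x 0 t))))"
proof -
  interpret X: Metric_space "cont_space a b" "mdist (cont_metric a b)"
    using Metric_space_mspace_mdist[of "cont_metric a b"] by (simp add: mspace_cont_metric)
  have L0: "0 \<le> L"
    using assms(5,7,13) by simp
  have T: "T \<in> cont_space a b \<rightarrow> cont_space a b"
    using assms(11,12) by (simp add: hammerstein_well_defined_def)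
  have con: "mdist (cont_metric a b) (T x) (T y) \<le> L * mdist (cont_metric a b) x y"
    if "x \<in> cont_space a b" "y \<in> cont_space a b" for x y
    using hammerstein_op_contraction[of a b K L\<^sub>f f g x y] assms that by auto
  have sol_iff: "hammerstein_solution a b g K f z \<longleftrightarrow> T z = z" if "z \<in> cont_space a b" for z
    using hammerstein_solution_iff_fixed_point[OF that] assms(12) by simp
  have in_C: "z \<in> C" if "z \<in> cont_space a b" "T z = z" for z
  proof -
    have "\<bar>f s 0\<bar> \<le> M\<^sub>f\<^sub>0" if "s \<in> {a..b}" for s
      using assms(9,10) that by (auto intro: cSUP_upper)
    moreover have "hammerstein_solution a b g K f z"
      using sol_iff that by simp
    ultimately have "sup_norm a b z \<le> R"
      using sup_norm_hammerstein_solution_le[of a b g K M L\<^sub>f f M\<^sub>f\<^sub>0 z] assms that by auto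
    with that show ?thesis using assms(16) by simp
  qed
  have C: "x \<in> cont_space a b" if "x \<in> C" for x
    using that assms(16) by simp
  \<comment> \<open>The fixed point theorem asks for a nonempty space; \<open>g\<close> is a
    witness.\<close>
  have "cont_space a b \<noteq> {}"
    using assms(2) by auto
  then obtain z where z: "z \<in> cont_space a b" "T z = z"
    using X.Banach_fixedpoint_thm[OF mcomplete_cont_metric _ T assms(14) con] by blast
  show ?thesis
  proof (intro conjI ex1I[of _ z] ballI allI impI)
    show "z \<in> C" "hammerstein_solution a b g K f z"
      using in_C sol_iff z by auto
    \<comment> \<open>Uniqueness in \<open>C\<close> is inherited from uniqueness of the fixed point
      in the whole space.\<close>
    show "y = z" if "y \<in> C \<and> hammerstein_solution a b g K f y" for y
      using X.contraction_imp_unique_fixpoint[OF _ z(2) T assms(14) con _ z(1)] that C sol_iff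
      by blast
  next
    \<comment> \<open>This \<open>z\<close> is an arbitrary solution in \<open>C\<close>, not the
      one obtained above; the error bound uses only that it is a fixed point.\<close>
    fix z x n
    assume z: "z \<in> C" "hammerstein_solution a b g K f z"
      and x: "x 0 \<in> C" "\<forall>n. x (Suc n) = T (x n)"
    \<comment> \<open>Membership of the iterates lets the metric be read back as the sup norm; the
      instance \<open>Suc 0\<close> covers \<open>T (x 0)\<close>.\<close>
    have xX: "x m \<in> cont_space a b" for m
      by (induction m) (use T C x in auto)
    have "mdist (cont_metric a b) (x n) z
        \<le> L ^ n / (1 - L) * mdist (cont_metric a b) (T (x 0)) (x 0)"
      using z x C sol_iff by (intro X.Picard_iterates_bound[OF T L0 assms(14) con]) auto
    then show "sup_norm a b (\<lambda>t. x n t - z t)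
        \<le> L ^ n / (1 - L) * sup_norm a b (\<lambda>t. T (x 0) t - x 0 t)"
      using mdist_cont_metric[OF assms(1)] xX[of n] xX[of 0] xX[of "Suc 0"] x(2) C[OF z(1)] by simp
  qed
qed

end
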